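(* Let $n\geq 4$ and let $G=S_n$ or $G=A_n$. Then $$\gamma(G)\leq\begin{cases}\left\lfloor \frac{n+4}{4}\right\rfloor & \text{if } G=S_n \text{ or } A_n \text{ with } n \text{ even},\\[2pt] \frac{n-1}{2} & \text{if } G=S_n \text{ with } n \text{ odd},\\[2pt] \left\lfloor\frac{n+3}{3}\right\rfloor & \text{if } G=A_n \text{ with } n \text{ odd}.\end{cases}$$
   Context: $S_n$ and $A_n$ denote the symmetric and alternating groups on $\{1,\dots,n\}$. For a finite group $G$, a basic set for $G$ is a set $\{H_1,\dots,H_k\}$ of pairwise non-conjugate proper subgroups of $G$ such that $G=\bigcup_{i=1}^k\bigcup_{g\in G}H_i^g$. A basic set exists if and only if $G$ is non-cyclic. For non-cyclic finite $G$, $\gamma(G)$ denotes the smallest size of a basic set for $G$. *)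

theory Defs
  imports "HOL-Algebra.Algebra"
begin

definition conj_subset :: "('a, 'b) monoid_scheme \<Rightarrow> 'a set \<Rightarrow> 'a \<Rightarrow> 'a set"
  where "conj_subset G H g = inv\<^bsub>G\<^esub> g <#\<^bsub>G\<^esub> (H #>\<^bsub>G\<^esub> g)"

definition conjugate_in :: "('a, 'b) monoid_scheme \<Rightarrow> 'a set \<Rightarrow> 'a set \<Rightarrow> bool"
  where "conjugate_in G H K \<longleftrightarrow> (\<exists>g \<in> carrier G. K = conj_subset G H g)"

definition basic_set :: "('a, 'b) monoid_scheme \<Rightarrow> 'a set set \<Rightarrow> bool"
  where "basic_set G \<H> \<longleftrightarrow>
    finite \<H> \<and>
    (\<forall>H \<in> \<H>. subgroup H G \<and> H \<noteq> carrier G) \<and>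
    (\<forall>H \<in> \<H>. \<forall>K \<in> \<H>. H \<noteq> K \<longrightarrow> \<not> conjugate_in G H K) \<and>
    carrier G = (\<Union>H \<in> \<H>. \<Union>g \<in> carrier G. conj_subset G H g)"

(* For finite cyclic G there is no basic set and the value is unspecified, so any
   upper bound on gamma G requires exhibiting a basic set. *)
definition gamma :: "('a, 'b) monoid_scheme \<Rightarrow> nat"
  where "gamma G = (LEAST k. \<exists>\<H>. basic_set G \<H> \<and> card \<H> = k)"

end

theory Submission
  imports Defs "HOL-Combinatorics.Orbits" "HOL-Number_Theory.Residue_Primitive_Roots"
begin

text \<open>
  The covering subgroups are the setwise stabilizers of \<open>{1..k}\<close>, which catch every permutation with
  an invariant set of size \<open>k\<close>, together with one further transitive subgroup.
  For even \<open>n\<close>, if some orbit has odd size then it or its complement has odd size \<open>k \<le> n / 2\<close>;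
  if \<open>k = n / 2\<close> or if all orbits have even size, the permutation preserves a partition into two
  halves.
  For odd \<open>n\<close> an even permutation has an odd number of orbits, so it is an \<open>n\<close>-cycle or it has an
  orbit of size at most \<open>n / 3\<close>.
  In \<open>S\<^sub>n\<close> with \<open>n\<close> odd, one \<open>k = m\<close> may be left out of \<open>1, \<dots>, (n - 1) / 2\<close>: the permutations that
  are then missed have all orbit sizes in \<open>{m, n - m, n}\<close>. If \<open>m\<close> is a proper divisor of \<open>n\<close>, they
  preserve a partition into \<open>m\<close> blocks; if \<open>n\<close> is prime and \<open>m = 1\<close>, they are conjugate to affine
  maps modulo \<open>n\<close>.
\<close>

hide_const (open) Group_Action.orbit Divisibility.prime

subsection \<open>Orbits and signs of permutations\<close>

text \<open>\<open>cycle_of_list\<close> peels off one transposition per pair of neighbouring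
  entries, and each flips the sign. For the empty list the truncated exponent is 0, matching the
  identity.\<close>

lemma sign_cycle_of_list:
  assumes "distinct cs"
  shows "sign (cycle_of_list cs) = (-1) ^ (length cs - 1)"
  using assms
proof (induction cs rule: cycle_of_list.induct)
  case (1 i j cs)
  then have "sign (cycle_of_list (i # j # cs)) = - sign (cycle_of_list (j # cs))"
    by (simp add: sign_compose permutation_swap_id permutation_of_cycle sign_swap_id)
  with 1 show ?case by (simp del: cycle_of_list.simps)
qed (simp_all flip: id_def)

text \<open>A power of the cycle moves an entry that many places along the list, cyclically, so
  every entry is reached from every other.\<close>

lemma orbit_cycle_of_list:
  assumes "distinct cs" "x \<in> set cs"
  shows "orbit (cycle_of_list cs) x = set cs"
proof
  show "orbit (cycle_of_list cs) x \<subseteq> set cs"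
    using permutes_orbit_subset[OF cycle_permutes assms(2)] .
next
  obtain i where i: "i < length cs" "x = cs ! i"
    using assms(2) by (auto simp: in_set_conv_nth)
  have pow: "(cycle_of_list cs ^^ k) x = cs ! ((k + i) mod length cs)" for k
    using arg_cong[OF cyclic_rotation[OF assms(1), of k], of "\<lambda>l. l ! i"] i
    by (simp add: nth_rotate add.commute)
  show "set cs \<subseteq> orbit (cycle_of_list cs) x"
  proof
    fix y assume "y \<in> set cs"
    then obtain j where j: "j < length cs" "y = cs ! j"
      by (auto simp: in_set_conv_nth)
    \<comment> \<open>Going once past the end of the list makes the exponent positive, as
      \<open>orbit\<close> demands.\<close>
    have "(cycle_of_list cs ^^ (length cs - i + j)) x = y"
      unfolding pow using i j by simp
    moreover have "length cs - i + j > 0" using i by simp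
    ultimately show "y \<in> orbit (cycle_of_list cs) x"
      unfolding orbit_altdef by blast
  qed
qed

text \<open>A cycle of length l has sign (-1)^(l-1), so each orbit costs one sign compared with
  (-1)^l; fixed points count as orbits of size 1. The cycle decomposition multiplies these
  contributions.\<close>

lemma sign_eq_card_orbits:
  assumes "p permutes S" "finite S"
  shows "sign p * (-1) ^ card (orbit p ` S) = (-1) ^ card S"
proof -
  \<comment> \<open>The induction carries along that \<open>p\<close> permutes the finite set
    \<open>S\<close>, in order to split signs and cardinalities.\<close>
  have "p permutes S \<and> finite S \<and> sign p * (-1) ^ card (orbit p ` S) = (-1) ^ card S"
    if "cycle_decomp S p" for p and S :: "'a set"
    using that
  proof induction
    case empty
    then show ?case by (simp add: permutes_id flip: id_def)
  next
    case (comp I p cs)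
    let ?c = "cycle_of_list cs" let ?q = "?c \<circ> p"
    have p: "p permutes I" "finite I"
      and sgn: "sign p * (-1) ^ card (orbit p ` I) = (-1) ^ card I"
      using comp.IH by auto
    have c: "?c permutes set cs" by (rule cycle_permutes)
    have perm: "?q permutes (set cs \<union> I)"
      using permutes_subset[OF c] permutes_subset[OF p(1)]
      by (intro permutes_compose) auto
    have card: "card (set cs \<union> I) = length cs + card I"
      using comp.hyps p by (simp add: card_Un_disjoint distinct_card)
    have sq: "sign ?q = sign ?c * sign p"
      using p by (intro sign_compose permutation_of_cycle) (auto simp: permutation_permutes)
    have dis: "y \<notin> set cs" if "y \<in> I" for y using comp.hyps that by auto
    have oI: "orbit ?q x = orbit p x" if "x \<in> I" for x
    proof (rule orbit_cong0[of _ I])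
      show "?q \<in> I \<rightarrow> I" "\<And>y. y \<in> I \<Longrightarrow> ?q y = p y"
        using permutes_in_image[OF p(1)] permutes_not_in[OF c] dis by auto
    qed fact
    have oc: "orbit ?q x = set cs" if "x \<in> set cs" for x
    proof -
      have "orbit ?q x = orbit ?c x"
      proof (rule orbit_cong0[of _ "set cs"])
        show "?q \<in> set cs \<rightarrow> set cs" "\<And>y. y \<in> set cs \<Longrightarrow> ?q y = ?c y"
          using permutes_in_image[OF c] permutes_not_in[OF p(1)] dis by fastforce+
      qed fact
      then show ?thesis using orbit_cycle_of_list comp.hyps that by metis
    qed
    show ?case
    \<comment> \<open>\<open>cycle_decomp\<close> admits an empty cycle, which acts as the identity
      and adds no orbit.\<close>
    proof (cases "cs = []")
      case True
      then show ?thesis using p sgn by simp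
    next
      case False
      then have "orbit ?q ` set cs = {set cs}"
        using oc by (auto simp: image_iff ex_in_conv)
      moreover have "orbit ?q ` I = orbit p ` I" using oI by (rule image_cong[OF refl])
      ultimately have im: "orbit ?q ` (set cs \<union> I) = insert (set cs) (orbit p ` I)"
        by (simp add: image_Un)
      have "set cs \<notin> orbit p ` I"
      proof
        assume "set cs \<in> orbit p ` I"
        then have "set cs \<subseteq> I" using permutes_orbit_subset[OF p(1)] by auto
        then show False using comp.hyps(3) False by (cases cs) auto
      qed
      then have co: "card (orbit ?q ` (set cs \<union> I)) = Suc (card (orbit p ` I))"
        unfolding im using p by simp
      obtain l where l: "length cs = Suc l" using False by (cases cs) auto
      have "sign ?q * (-1) ^ card (orbit ?q ` (set cs \<union> I))
        = (-1) ^ length cs * (sign p * (-1) ^ card (orbit p ` I))"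
        unfolding co sq sign_cycle_of_list[OF comp.hyps(2)] by (simp add: l)
      also have "\<dots> = (-1) ^ card (set cs \<union> I)"
        unfolding sgn card by (simp add: power_add)
      finally show ?thesis using perm p(2) by (intro conjI) (rule | simp only: finite_Un finite_set)+
    qed
  qed
  then show ?thesis using cycle_decomposition[OF assms] by blast
qed

section \<open>Cyclic colourings and permutations that match colourings\<close>

text \<open>The size of the orbit is the least positive exponent that fixes \<open>x\<close>, and it
  divides every exponent that does.\<close>

lemma funpow_eq_imp_cong_card_orbit:
  assumes "permutation p" "(p ^^ i) x = (p ^^ j) x"
  shows "[i = j] (mod card (orbit p x))"
proof -
  have "orbit p x = set (support p x)"
    unfolding support_set[OF assms(1)] orbit_altdef_permutation[OF assms(1)] by auto
  then have card: "card (orbit p x) = least_power p x"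
    using distinct_card[OF cycle_of_permutation[OF assms(1), of x]] by simp
  have *: "card (orbit p x) dvd b - a" if "a \<le> b" "(p ^^ a) x = (p ^^ b) x" for a b
    using funpow_diff[OF bij_is_inj that] assms(1)
    by (simp add: permutation least_power_dvd card)
  show ?thesis
  proof (cases "i \<le> j")
    case True
    then show ?thesis using *[OF True assms(2)] cong_altdef_nat by (metis cong_sym)
  next
    case False
    then show ?thesis using *[of j i] assms(2) cong_altdef_nat by auto
  qed
qed

text \<open>The colour of a point is its distance, modulo \<open>m\<close>, from a chosen representative of its orbit.\<close>

lemma obtain_cyclic_colouring:
  fixes m :: nat
  assumes "permutation p" "m > 0"
  obtains f where "\<And>x. f x < m"
    and "\<And>x. m dvd card (orbit p x) \<Longrightarrow> f (p x) = Suc (f x) mod m"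
proof
  define r where "r x = (SOME y. y \<in> orbit p x)" for x
  define f where "f x = funpow_dist p (r x) x mod m" for x
  show "f x < m" for x using assms(2) by (simp add: f_def)
  show "f (p x) = Suc (f x) mod m" if m: "m dvd card (orbit p x)" for x
  proof -
    have self: "y \<in> orbit p y" for y using assms(1) by (rule permutation_self_in_orbit)
    have o: "orbit p y = orbit p x" if "y \<in> orbit p x" for y
      using that cyclic_on_orbit'[OF assms(1)] orbit_cyclic_eq3 by metis
    have px: "orbit p (p x) = orbit p x" by (rule o) (rule orbit.base)
    have r: "r x \<in> orbit p x" unfolding r_def using self by (rule someI)
    \<comment> \<open>The representative is chosen from the orbit as a set, so points of one orbit
      share it.\<close>
    have rp: "r (p x) = r x" unfolding r_def px ..
    have "x \<in> orbit p (r x)" using o[OF r] self by metis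
    then have 1: "(p ^^ funpow_dist p (r x) x) (r x) = x" by (rule funpow_dist_prop)
    have "p x \<in> orbit p (r x)" using o[OF r] px self by metis
    then have "(p ^^ funpow_dist p (r x) (p x)) (r x) = p x" by (rule funpow_dist_prop)
    also have "\<dots> = (p ^^ Suc (funpow_dist p (r x) x)) (r x)" using 1 by simp
    \<comment> \<open>Both exponents lead from \<open>r x\<close> to \<open>p x\<close>, so they
      agree modulo the orbit size even where the least distance drops back to 0.\<close>
    finally have "[funpow_dist p (r x) (p x) = Suc (funpow_dist p (r x) x)] (mod card (orbit p x))"
      using funpow_eq_imp_cong_card_orbit[OF assms(1)] o[OF r] by metis
    then have "[funpow_dist p (r x) (p x) = Suc (funpow_dist p (r x) x)] (mod m)"
      using m by (rule cong_dvd_modulus_nat)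
    then show ?thesis unfolding f_def rp cong_def by (simp add: mod_Suc_eq)
  qed
qed

text \<open>\<open>p\<close> maps each colour class bijectively onto the next, cyclically, so all
  \<open>m\<close> classes have the same size.\<close>

lemma card_fibres_cyclic_colouring:
  fixes m :: nat
  assumes S: "finite S" "bij_betw p S S"
    and f: "\<And>x. x \<in> S \<Longrightarrow> f x < m" "\<And>x. x \<in> S \<Longrightarrow> f (p x) = Suc (f x) mod m"
    and i: "i < m"
  shows "card {x \<in> S. f x = i} = card S div m"
proof -
  have *: "card {x \<in> S. f x = Suc j mod m} = card {x \<in> S. f x = j}" if "j < m" for j
  proof -
    have "p ` {x \<in> S. f x = j} = {x \<in> S. f x = Suc j mod m}"
    proof (intro equalityI subsetI)
      fix y assume "y \<in> p ` {x \<in> S. f x = j}"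
      then show "y \<in> {x \<in> S. f x = Suc j mod m}" using S f by (auto simp: bij_betw_def)
    next
      fix y assume y: "y \<in> {x \<in> S. f x = Suc j mod m}"
      then obtain x where x: "x \<in> S" "y = p x" using S by (auto simp: bij_betw_def)
      then have "Suc (f x) mod m = Suc j mod m" using y f by simp
      then have "f x = j" using f(1)[OF x(1)] that by (auto simp: mod_Suc split: if_splits)
      then show "y \<in> p ` {x \<in> S. f x = j}" using x by auto
    qed
    moreover have "inj_on p {x \<in> S. f x = j}"
      by (rule inj_on_subset[OF bij_betw_imp_inj_on[OF S(2)]]) auto
    ultimately show ?thesis using card_image[of p "{x \<in> S. f x = j}"] by simp
  qed
  have eq0: "j < m \<Longrightarrow> card {x \<in> S. f x = j} = card {x \<in> S. f x = 0}" for j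
  proof (induction j)
    case (Suc j)
    then show ?case using *[of j] by simp
  qed simp
  have "S = (\<Union>j<m. {x \<in> S. f x = j})" using f(1) by auto
  then have "card S = card (\<Union>j<m. {x \<in> S. f x = j})" by simp
  also have "\<dots> = (\<Sum>j<m. card {x \<in> S. f x = j})"
    using S(1) by (intro card_UN_disjoint) auto
  also have "\<dots> = (\<Sum>j<m. card {x \<in> S. f x = 0})"
    by (rule sum.cong[OF refl], rule eq0) simp
  also have "\<dots> = m * card {x \<in> S. f x = 0}" by simp
  finally show ?thesis using eq0[OF i] i by simp
qed

text \<open>Bijections between classes of equal colour glue together. The resulting \<open>t\<close>
  serves as the conjugator that carries a colouring derived from a permutation to a standard
  one.\<close>

lemma obtain_permutes_matching_colours:
  assumes S: "finite S" and card: "\<And>i. card {x \<in> S. f x = i} = card {x \<in> S. g x = i}"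
  obtains t where "t permutes S" "\<And>x. x \<in> S \<Longrightarrow> g (t x) = f x"
proof -
  have "\<exists>h. bij_betw h {x \<in> S. f x = i} {x \<in> S. g x = i}" for i
    using S card[of i] by (intro finite_same_card_bij) auto
  then obtain h where h: "\<And>i. bij_betw (h i) {x \<in> S. f x = i} {x \<in> S. g x = i}" by metis
  define t where "t x = h (f x) x" for x
  have mem: "t x \<in> S" "g (t x) = f x" if "x \<in> S" for x
    using bij_betwE[OF h[of "f x"]] that by (auto simp: t_def)
  have "inj_on t S"
  proof (rule inj_onI)
    fix x y assume xy: "x \<in> S" "y \<in> S" "t x = t y"
    then have "f x = f y" using mem(2) by metis
    then show "x = y"
      using xy bij_betw_imp_inj_on[OF h[of "f x"]] by (auto simp: t_def inj_on_def)
  qed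
  moreover have "t ` S \<subseteq> S" using mem(1) by blast
  ultimately have "bij_betw t S S"
    using endo_inj_surj[OF S] unfolding bij_betw_def by blast
  then show ?thesis
    using that[of "restrict_id t S"] permutes_restrict_id mem by auto
qed

text \<open>Three-cycles supply the even permutations outside a given subgroup.\<close>

lemma obtain_three_cycle:
  assumes "a \<in> S" "b \<in> S" "c \<in> S" "distinct [a, b, c]"
  obtains p where "p permutes S" "evenperm p" "p a = b" "p b = c" "p c = a"
    "\<forall>x. x \<notin> {a, b, c} \<longrightarrow> p x = x"
proof
  let ?p = "transpose a b \<circ> transpose b c"
  show "?p permutes S" using assms by (intro permutes_compose permutes_swap_id)
  show "evenperm ?p" using assms by (simp add: evenperm_comp evenperm_swap permutation_swap_id)
qed (use assms in \<open>auto simp: transpose_def\<close>)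

subsection \<open>Families of subgroups that cover up to conjugacy\<close>

lemma (in group) mem_conj_subset_iff:
  assumes "H \<subseteq> carrier G" "g \<in> carrier G" "x \<in> carrier G"
  shows "x \<in> conj_subset G H g \<longleftrightarrow> g \<otimes> x \<otimes> inv g \<in> H"
proof
  assume "x \<in> conj_subset G H g"
  then obtain h where h: "h \<in> H" "x = inv g \<otimes> (h \<otimes> g)"
    by (auto simp: conj_subset_def l_coset_def r_coset_def)
  then have hc: "h \<in> carrier G" using assms by auto
  have "g \<otimes> x = h \<otimes> g"
    using h hc assms by (simp flip: m_assoc)
  then have "g \<otimes> x \<otimes> inv g = h" using hc assms by (simp add: m_assoc)
  then show "g \<otimes> x \<otimes> inv g \<in> H" using h by simp
next
  assume *: "g \<otimes> x \<otimes> inv g \<in> H"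
  have "x = inv g \<otimes> (g \<otimes> x \<otimes> inv g \<otimes> g)"
    using assms by (simp add: m_assoc) (simp flip: m_assoc)
  then show "x \<in> conj_subset G H g"
    using * by (auto simp: conj_subset_def l_coset_def r_coset_def)
qed

text \<open>
  The members of \<open>\<H>\<close> may be conjugate: a subfamily of minimal cardinality that still covers has
  no two conjugate members.
\<close>

lemma (in group) gamma_le_card:
  assumes fin: "finite \<H>"
    and sub: "\<And>H. H \<in> \<H> \<Longrightarrow> subgroup H G" "\<And>H. H \<in> \<H> \<Longrightarrow> H \<noteq> carrier G"
    and cover: "\<And>x. x \<in> carrier G \<Longrightarrow> \<exists>H\<in>\<H>. \<exists>g\<in>carrier G. g \<otimes> x \<otimes> inv g \<in> H"
  shows "gamma G \<le> card \<H>"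
proof -
  define P where "P \<K> \<longleftrightarrow> \<K> \<subseteq> \<H> \<and>
    (\<forall>x\<in>carrier G. \<exists>H\<in>\<K>. \<exists>g\<in>carrier G. g \<otimes> x \<otimes> inv g \<in> H)" for \<K>
  have "P \<H>" using cover by (simp add: P_def)
  then obtain \<K> where K: "P \<K>" and min: "\<And>\<L>. P \<L> \<Longrightarrow> card \<K> \<le> card \<L>"
    using ex_has_least_nat[of P \<H> card] by blast
  have KH: "\<K> \<subseteq> \<H>" using K by (simp add: P_def)
  have finK: "finite \<K>" using KH fin finite_subset by blast
  have carr: "H \<subseteq> carrier G" if "H \<in> \<K>" for H
    using that KH sub(1) subgroup.subset by blast
  have "\<not> conjugate_in G H K" if H: "H \<in> \<K>" "K \<in> \<K>" "H \<noteq> K" for H K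
  proof
    assume "conjugate_in G H K"
    then obtain g where g: "g \<in> carrier G" "K = conj_subset G H g"
      by (auto simp: conjugate_in_def)
    have "P (\<K> - {K})"
      unfolding P_def
    proof (intro conjI ballI)
      show "\<K> - {K} \<subseteq> \<H>" using KH by auto
      fix x assume x: "x \<in> carrier G"
      then obtain L y where L: "L \<in> \<K>" "y \<in> carrier G" "y \<otimes> x \<otimes> inv y \<in> L"
        using K by (auto simp: P_def)
      show "\<exists>H\<in>\<K> - {K}. \<exists>g\<in>carrier G. g \<otimes> x \<otimes> inv g \<in> H"
      proof (cases "L = K")
        case False
        then show ?thesis using L by auto
      next
        case True
        have "g \<otimes> (y \<otimes> x \<otimes> inv y) \<otimes> inv g \<in> H"
          using L x g True mem_conj_subset_iff[OF carr[OF H(1)] g(1)] by auto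
        also have "g \<otimes> (y \<otimes> x \<otimes> inv y) \<otimes> inv g = (g \<otimes> y) \<otimes> x \<otimes> inv (g \<otimes> y)"
          using L x g by (simp add: inv_mult_group m_assoc)
        finally show ?thesis using L g H by blast
      qed
    qed
    then have "card \<K> \<le> card (\<K> - {K})" by (rule min)
    moreover have "card (\<K> - {K}) < card \<K>"
      using finK H by (intro card_Diff1_less) auto
    ultimately show False by simp
  qed
  moreover have "carrier G = (\<Union>H\<in>\<K>. \<Union>g\<in>carrier G. conj_subset G H g)"
  proof (intro equalityI subsetI)
    fix x assume x: "x \<in> carrier G"
    then obtain H g where "H \<in> \<K>" "g \<in> carrier G" "g \<otimes> x \<otimes> inv g \<in> H"
      using K by (auto simp: P_def)
    then show "x \<in> (\<Union>H\<in>\<K>. \<Union>g\<in>carrier G. conj_subset G H g)"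
      using mem_conj_subset_iff[OF carr _ x] by auto
  next
    fix x assume "x \<in> (\<Union>H\<in>\<K>. \<Union>g\<in>carrier G. conj_subset G H g)"
    then obtain H g h where *: "H \<in> \<K>" "g \<in> carrier G" "h \<in> H" "x = inv g \<otimes> (h \<otimes> g)"
      by (auto simp: conj_subset_def l_coset_def r_coset_def)
    then have "h \<in> carrier G" using carr by blast
    then show "x \<in> carrier G" using * by simp
  qed
  ultimately have "basic_set G \<K>"
    unfolding basic_set_def using finK KH sub by (intro conjI ballI impI; simp add: subset_iff)
  then have "gamma G \<le> card \<K>" unfolding gamma_def by (intro Least_le) auto
  also have "\<dots> \<le> card \<H>" using card_mono[OF fin KH] .
  finally show ?thesis .
qed

section \<open>Covering bounds for symmetric and alternating groups\<close>

text \<open>A permutation of a finite set has finite order, so its inverse is one of its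
  powers.\<close>

lemma subgroup_sym_groupI:
  assumes H: "\<And>p. p \<in> H \<Longrightarrow> p permutes {1..n}" "id \<in> H"
    and closed: "\<And>p q. p \<in> H \<Longrightarrow> q \<in> H \<Longrightarrow> p \<circ> q \<in> H"
  shows "subgroup H (sym_group n)"
proof
  fix p assume p: "p \<in> H"
  have pow: "p ^^ k \<in> H" for k
  proof (induction k)
    case 0
    then show ?case using H(2) by (simp only: funpow.simps)
  next
    case (Suc k)
    then show ?case using closed[OF p Suc] by (simp only: funpow.simps)
  qed
  have perm: "permutation p" using H(1)[OF p] by (auto simp: permutation_permutes)
  obtain k where k: "p ^^ k = id" "k > 0" using permutation_is_nilpotent'[OF perm] .
  then have "p \<circ> p ^^ (k - 1) = id" by (metis Suc_diff_1 funpow.simps(2))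
  then have "inv' p = p ^^ (k - 1)"
    using permutation_bijective[OF perm] by (metis bij_is_inj comp_assoc id_comp inv_o_cancel comp_id)
  then show "inv\<^bsub>sym_group n\<^esub> p \<in> H"
    using pow H(1)[OF p] by (simp add: sym_group_carrier)
qed (use assms in \<open>auto simp: sym_group_carrier sym_group_mult sym_group_one\<close>)

text \<open>The conjugator ranges over the whole symmetric group, also for coverings of the
  alternating group, so that only the cycle structure of \<open>p\<close> matters.\<close>

definition conj_into :: "nat \<Rightarrow> (nat \<Rightarrow> nat) \<Rightarrow> (nat \<Rightarrow> nat) set \<Rightarrow> bool" where
  "conj_into n p H \<longleftrightarrow> (\<exists>t. t permutes {1..n} \<and> t \<circ> p \<circ> inv' t \<in> H)"

text \<open>
  The odd element turns conjugacy under \<open>S\<^sub>n\<close> into conjugacy under \<open>A\<^sub>n\<close>; the missing even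
  permutation makes the intersection with \<open>A\<^sub>n\<close> proper.
\<close>

definition admissible :: "nat \<Rightarrow> (nat \<Rightarrow> nat) set \<Rightarrow> bool" where
  "admissible n H \<longleftrightarrow> subgroup H (sym_group n) \<and> (\<exists>p\<in>H. \<not> evenperm p) \<and>
     (\<exists>p. p permutes {1..n} \<and> evenperm p \<and> p \<notin> H)"

lemma gamma_sym_group_le:
  assumes "finite \<H>" "\<And>H. H \<in> \<H> \<Longrightarrow> admissible n H"
    and "\<And>p. p permutes {1..n} \<Longrightarrow> \<exists>H\<in>\<H>. conj_into n p H"
  shows "gamma (sym_group n) \<le> card \<H>"
proof (rule group.gamma_le_card[OF sym_group_is_group assms(1)])
  fix H assume "H \<in> \<H>"
  from assms(2)[OF this] show "subgroup H (sym_group n)" "H \<noteq> carrier (sym_group n)"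
    by (auto simp: admissible_def sym_group_carrier)
next
  fix p assume "p \<in> carrier (sym_group n)"
  then obtain H t where "H \<in> \<H>" "t permutes {1..n}" "t \<circ> p \<circ> inv' t \<in> H"
    using assms(3)[of p] unfolding sym_group_carrier conj_into_def by blast
  then show "\<exists>H\<in>\<H>. \<exists>g\<in>carrier (sym_group n).
      g \<otimes>\<^bsub>sym_group n\<^esub> p \<otimes>\<^bsub>sym_group n\<^esub> inv\<^bsub>sym_group n\<^esub> g \<in> H"
    by (intro bexI[of _ H] bexI[of _ t]) (simp_all add: sym_group_carrier sym_group_mult)
qed

text \<open>The family is intersected with the alternating group. An odd conjugator becomes even by
  composing it with an odd \<open>s\<close> in \<open>H\<close>, and conjugation by \<open>s\<close>
  stays inside \<open>H\<close>. Members with equal intersections only lower the count.\<close>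

lemma gamma_alt_group_le:
  assumes "finite \<H>" "\<And>H. H \<in> \<H> \<Longrightarrow> admissible n H"
    and "\<And>p. p permutes {1..n} \<Longrightarrow> evenperm p \<Longrightarrow> \<exists>H\<in>\<H>. conj_into n p H"
  shows "gamma (alt_group n) \<le> card \<H>"
proof -
  let ?A = "carrier (alt_group n)"
  interpret A: group "alt_group n" by (rule alt_group_is_group)
  have "gamma (alt_group n) \<le> card ((\<lambda>H. H \<inter> ?A) ` \<H>)"
  proof (rule A.gamma_le_card)
    show "finite ((\<lambda>H. H \<inter> ?A) ` \<H>)" using assms(1) by simp
  next
    fix K assume "K \<in> (\<lambda>H. H \<inter> ?A) ` \<H>"
    then obtain H where H: "H \<in> \<H>" "K = H \<inter> ?A" by auto
    from assms(2)[OF H(1)] obtain p where "p \<in> ?A" "p \<notin> H"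
      unfolding admissible_def alt_group_carrier by blast
    then show "K \<noteq> ?A" using H by auto
    interpret subgroup H "sym_group n" using H assms(2) by (simp add: admissible_def)
    show "subgroup K (alt_group n)"
    proof
      show "K \<subseteq> ?A" using H by auto
      show "\<one>\<^bsub>alt_group n\<^esub> \<in> K"
        using H one_closed by (simp add: alt_group_one sym_group_one alt_group_carrier permutes_id)
    next
      fix x y assume "x \<in> K" "y \<in> K"
      then show "x \<otimes>\<^bsub>alt_group n\<^esub> y \<in> K"
        using H m_closed[of x y] A.m_closed[of x y] by (simp add: alt_group_mult sym_group_mult)
    next
      fix x assume x: "x \<in> K"
      then have "x \<in> carrier (sym_group n)" using H mem_carrier by blast
      then show "inv\<^bsub>alt_group n\<^esub> x \<in> K"
        using H x m_inv_closed[of x] A.inv_closed[of x] by (simp add: alt_group_inv_equality)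
    qed
  next
    fix p assume p: "p \<in> ?A"
    then obtain H t where H: "H \<in> \<H>" and t: "t permutes {1..n}" "t \<circ> p \<circ> inv' t \<in> H"
      using assms(3)[of p] unfolding alt_group_carrier conj_into_def by blast
    interpret subgroup H "sym_group n" using H assms(2) by (simp add: admissible_def)
    obtain u where u: "u permutes {1..n}" "evenperm u" "u \<circ> p \<circ> inv' u \<in> H"
    proof (cases "evenperm t")
      case True
      then show ?thesis using that t by blast
    next
      case False
      obtain s where s: "s \<in> H" "\<not> evenperm s" using H assms(2) by (auto simp: admissible_def)
      then have sp: "s permutes {1..n}" using mem_carrier sym_group_carrier by blast
      have "s \<circ> (t \<circ> p \<circ> inv' t) \<circ> inv' s \<in> H"
        using m_closed[OF m_closed[OF s(1) t(2)] m_inv_closed[OF s(1)]]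
        unfolding sym_group_mult sym_group_inv_equality[OF mem_carrier[OF s(1)]] .
      also have "s \<circ> (t \<circ> p \<circ> inv' t) \<circ> inv' s = (s \<circ> t) \<circ> p \<circ> inv' (s \<circ> t)"
        using o_inv_distrib[of s t] sp t(1) by (simp only: permutes_bij comp_assoc)
      finally have "(s \<circ> t) \<circ> p \<circ> inv' (s \<circ> t) \<in> H" .
      moreover have "s \<circ> t permutes {1..n}" using sp t by (simp add: permutes_compose)
      moreover have "evenperm (s \<circ> t)"
        using s(2) False evenperm_comp[of s t] permutes_imp_permutation[of "{1..n}"] sp t(1) by blast
      ultimately show ?thesis using that by blast
    qed
    then have uA: "u \<in> ?A" by (simp add: alt_group_carrier)
    have "u \<otimes>\<^bsub>alt_group n\<^esub> p \<otimes>\<^bsub>alt_group n\<^esub> inv\<^bsub>alt_group n\<^esub> u \<in> ?A"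
      using uA p by (intro A.m_closed A.inv_closed)
    moreover have "u \<otimes>\<^bsub>alt_group n\<^esub> p \<otimes>\<^bsub>alt_group n\<^esub> inv\<^bsub>alt_group n\<^esub> u \<in> H"
      using u(3) by (simp only: alt_group_inv_equality[OF uA] alt_group_mult)
    ultimately have "u \<otimes>\<^bsub>alt_group n\<^esub> p \<otimes>\<^bsub>alt_group n\<^esub> inv\<^bsub>alt_group n\<^esub> u \<in> H \<inter> ?A"
      by blast
    then show "\<exists>K\<in>(\<lambda>H. H \<inter> ?A) ` \<H>. \<exists>g\<in>?A.
        g \<otimes>\<^bsub>alt_group n\<^esub> p \<otimes>\<^bsub>alt_group n\<^esub> inv\<^bsub>alt_group n\<^esub> g \<in> K"
      using H(1) uA by (intro bexI[of _ "H \<inter> ?A"] bexI[of _ u]) simp_all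
  qed
  also have "\<dots> \<le> card \<H>" by (rule card_image_le[OF assms(1)])
  finally show ?thesis .
qed

text \<open>The conjugate \<open>q\<close> is described by its action on relabelled points, which
  keeps inverses out of later arguments.\<close>

lemma conj_intoI:
  assumes t: "t permutes {1..n}" and p: "p permutes {1..n}"
    and "\<And>q. q permutes {1..n} \<Longrightarrow> (\<And>x. x \<in> {1..n} \<Longrightarrow> q (t x) = t (p x)) \<Longrightarrow> q \<in> H"
  shows "conj_into n p H"
  unfolding conj_into_def
proof (intro exI[of _ t] conjI assms(3))
  show "t \<circ> p \<circ> inv' t permutes {1..n}"
    using t p by (intro permutes_compose permutes_inv)
  show "(t \<circ> p \<circ> inv' t) (t x) = t (p x)" for x
    using permutes_inverses(2)[OF t] by simp
qed (fact t)

subsection \<open>Intransitive, imprimitive and affine subgroups\<close>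

text \<open>For \<open>k \<le> n\<close> this is the intransitive subgroup S_k x S_(n-k).\<close>

definition set_stab :: "nat \<Rightarrow> nat \<Rightarrow> (nat \<Rightarrow> nat) set" where
  "set_stab n k = {p. p permutes {1..n} \<and> p ` {1..k} = {1..k}}"

text \<open>
  The blocks are the residue classes modulo \<open>m\<close>, so for \<open>m\<close> dividing \<open>n\<close> there are \<open>m\<close> blocks of
  size \<open>n div m\<close>.
\<close>

definition mod_stab :: "nat \<Rightarrow> nat \<Rightarrow> (nat \<Rightarrow> nat) set" where
  "mod_stab n m = {p. p permutes {1..n} \<and>
     (\<forall>x\<in>{1..n}. \<forall>y\<in>{1..n}. x mod m = y mod m \<longrightarrow> p x mod m = p y mod m)}"

text \<open>For prime \<open>n\<close> this is the affine group AGL(1, n) on the residues modulo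
  \<open>n\<close>, with the point \<open>n\<close> standing for 0.\<close>

definition affine_perms :: "nat \<Rightarrow> (nat \<Rightarrow> nat) set" where
  "affine_perms n = {p. p permutes {1..n} \<and> (\<exists>a b. \<forall>x\<in>{1..n}. p x mod n = (a * x + b) mod n)}"

section \<open>Admissibility of set and block stabilizers\<close>

text \<open>The odd member is a transposition inside \<open>{1..k}\<close>, or that of 2 and 3 if
  \<open>k = 1\<close>. A three-cycle taking \<open>k\<close> to \<open>Suc k\<close> is the even
  non-member.\<close>

lemma admissible_set_stab:
  assumes "1 \<le> k" "k < n" "n \<ge> 3"
  shows "admissible n (set_stab n k)"
  unfolding admissible_def
proof (intro conjI)
  show "subgroup (set_stab n k) (sym_group n)"
  proof (rule subgroup_sym_groupI)
    fix p q assume "p \<in> set_stab n k" "q \<in> set_stab n k"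
    then show "p \<circ> q \<in> set_stab n k"
      unfolding set_stab_def
      by (auto simp only: mem_Collect_eq image_comp[symmetric] intro: permutes_compose)
  qed (auto simp: set_stab_def permutes_id)
  show "\<exists>p\<in>set_stab n k. \<not> evenperm p"
  proof (cases "k = 1")
    case True
    then have "transpose 2 3 \<in> set_stab n k"
      using assms by (auto simp: set_stab_def transpose_def intro: permutes_swap_id)
    then show ?thesis by (intro bexI[of _ "transpose 2 3"]) (simp_all add: evenperm_swap)
  next
    case False
    have "transpose 1 2 ` {1..k} = {1..k}"
      using assms False by (intro permutes_image permutes_swap_id) auto
    then have "transpose 1 2 \<in> set_stab n k"
      using assms by (auto simp: set_stab_def intro: permutes_swap_id)
    then show ?thesis by (intro bexI[of _ "transpose 1 2"]) (simp_all add: evenperm_swap)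
  qed
  obtain c where c: "c \<in> {1..n}" "c \<noteq> k" "c \<noteq> Suc k"
  proof (cases "k = 1")
    case True
    then show ?thesis using that[of 3] assms by simp
  next
    case False
    then show ?thesis using that[of 1] assms by simp
  qed
  have "k \<in> {1..n}" "Suc k \<in> {1..n}" "distinct [k, Suc k, c]" using c assms by simp_all
  from obtain_three_cycle[OF this(1,2) c(1) this(3)] obtain p
    where p: "p permutes {1..n}" "evenperm p" "p k = Suc k" by blast
  have "p k \<in> p ` {1..k}" using assms(1) by (intro imageI) simp
  moreover have "p k \<notin> {1..k}" using p(3) by simp
  ultimately have "p \<notin> set_stab n k" unfolding set_stab_def by blast
  then show "\<exists>p. p permutes {1..n} \<and> evenperm p \<and> p \<notin> set_stab n k" using p by blast
qed

text \<open>Swapping 1 and \<open>Suc m\<close>, which lie in one residue class, gives the odd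
  member. The three-cycle from 1 to 2 to \<open>Suc m\<close> sends these two points to 2 and 1, in
  different classes.\<close>

lemma admissible_mod_stab:
  assumes "1 < m" "m < n"
  shows "admissible n (mod_stab n m)"
  unfolding admissible_def
proof (intro conjI)
  show "subgroup (mod_stab n m) (sym_group n)"
  proof (rule subgroup_sym_groupI)
    fix p q assume p: "p \<in> mod_stab n m" and q: "q \<in> mod_stab n m"
    have pq: "p permutes {1..n}" "q permutes {1..n}" using p q by (simp_all add: mod_stab_def)
    show "p \<circ> q \<in> mod_stab n m"
      unfolding mod_stab_def mem_Collect_eq o_apply
    proof (intro conjI ballI impI)
      show "(\<lambda>x. p (q x)) permutes {1..n}"
        using permutes_compose[OF pq(2,1)] by (simp add: o_def)
      fix x y assume xy: "x \<in> {1..n}" "y \<in> {1..n}" "x mod m = y mod m"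
      then have "q x mod m = q y mod m" using q unfolding mod_stab_def by blast
      moreover have "q x \<in> {1..n}" "q y \<in> {1..n}"
        using xy permutes_in_image[OF pq(2)] by blast+
      ultimately show "p (q x) mod m = p (q y) mod m" using p unfolding mod_stab_def by blast
    qed
  qed (auto simp: mod_stab_def permutes_id)
  have "Suc m mod m = 1" using assms by (simp add: mod_Suc)
  then have "transpose 1 (Suc m) x mod m = x mod m" for x
    using assms by (auto simp: transpose_def)
  then have "transpose 1 (Suc m) \<in> mod_stab n m"
    using assms by (auto simp: mod_stab_def intro: permutes_swap_id)
  then show "\<exists>p\<in>mod_stab n m. \<not> evenperm p"
    using assms by (intro bexI[of _ "transpose 1 (Suc m)"]) (simp_all add: evenperm_swap)
  have "1 \<in> {1..n}" "2 \<in> {1..n}" "Suc m \<in> {1..n}" "distinct [1, 2, Suc m]"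
    using assms by simp_all
  from obtain_three_cycle[OF this] obtain p
    where p: "p permutes {1..n}" "evenperm p" "p 1 = 2" "p (Suc m) = 1" by blast
  have "2 mod m \<noteq> 1 mod m" using assms by (cases "m = 2") auto
  moreover have "p 1 mod m = p (Suc m) mod m" if "p \<in> mod_stab n m"
  proof -
    have "\<forall>x\<in>{1..n}. \<forall>y\<in>{1..n}. x mod m = y mod m \<longrightarrow> p x mod m = p y mod m"
      using that unfolding mod_stab_def by blast
    then show ?thesis using \<open>Suc m mod m = 1\<close> assms by force
  qed
  ultimately have "p \<notin> mod_stab n m" using p by auto
  then show "\<exists>p. p permutes {1..n} \<and> evenperm p \<and> p \<notin> mod_stab n m" using p by blast
qed

section \<open>Conjugation into set stabilizers\<close>

text \<open>Membership in \<open>A\<close> and in \<open>{1..card A}\<close> are two-valued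
  colourings with equal class sizes; a permutation matching them takes the invariant set to the
  standard one.\<close>

lemma conj_into_set_stab:
  assumes p: "p permutes {1..n}" and A: "A \<subseteq> {1..n}" "p ` A = A"
  shows "conj_into n p (set_stab n (card A))"
proof -
  let ?k = "card A"
  have finA: "finite A" and le: "?k \<le> n"
    using A(1) finite_subset card_mono[of "{1..n}" A] by auto
  have card: "card {x \<in> {1..n}. (x \<in> A) = i} = card {x \<in> {1..n}. (x \<in> {1..?k}) = i}" for i
  proof -
    have "{x \<in> {1..n}. x \<in> A} = A" "{x \<in> {1..n}. x \<notin> A} = {1..n} - A"
      "{x \<in> {1..n}. x \<in> {1..?k}} = {1..?k}" "{x \<in> {1..n}. x \<notin> {1..?k}} = {1..n} - {1..?k}"
      using A(1) le by auto
    moreover have "card ({1..n} - A) = n - ?k" "card ({1..n} - {1..?k}) = n - ?k"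
      using A(1) finA le by (simp_all add: card_Diff_subset)
    ultimately show ?thesis by (cases i) auto
  qed
  obtain t where t: "t permutes {1..n}" "\<And>x. x \<in> {1..n} \<Longrightarrow> (t x \<in> {1..?k}) = (x \<in> A)"
    using obtain_permutes_matching_colours[OF _ card] by blast
  have tA: "t ` A = {1..?k}"
  proof (intro equalityI subsetI)
    fix y assume y: "y \<in> {1..?k}"
    then have "y \<in> t ` {1..n}" using le permutes_image[OF t(1)] by simp
    then obtain x where x: "x \<in> {1..n}" "y = t x" by blast
    then have "x \<in> A" using t(2)[of x] y by blast
    then show "y \<in> t ` A" using x(2) by blast
  qed (use t(2) A(1) in blast)
  show ?thesis
  proof (rule conj_intoI[OF t(1) p])
    fix q assume q: "q permutes {1..n}" "\<And>x. x \<in> {1..n} \<Longrightarrow> q (t x) = t (p x)"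
    have "q ` {1..?k} = (\<lambda>x. q (t x)) ` A" unfolding tA[symmetric] image_image ..
    also have "\<dots> = (\<lambda>x. t (p x)) ` A" using q(2) A(1) by (intro image_cong) auto
    also have "\<dots> = t ` p ` A" by (simp only: image_image)
    also have "\<dots> = {1..?k}" unfolding A(2) tA ..
    finally show "q \<in> set_stab n ?k" using q(1) by (simp add: set_stab_def)
  qed
qed

text \<open>An orbit and its complement are both invariant, so the smaller of the two can be
  used.\<close>

lemma conj_into_set_stab_orbit:
  assumes p: "p permutes {1..n}" and x: "x \<in> {1..n}"
  shows "conj_into n p (set_stab n (card (orbit p x)))"
    and "conj_into n p (set_stab n (n - card (orbit p x)))"
proof -
  let ?A = "orbit p x"
  have sub: "?A \<subseteq> {1..n}" using permutes_orbit_subset[OF p x] .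
  have A: "p ` ?A = ?A"
  proof (rule endo_inj_surj)
    show "finite ?A" using sub finite_subset by blast
    show "p ` ?A \<subseteq> ?A" by (auto intro: orbit.step)
    show "inj_on p ?A" using permutes_inj[OF p] inj_on_subset by blast
  qed
  then show "conj_into n p (set_stab n (card ?A))" using conj_into_set_stab[OF p sub] by blast
  have "p ` ({1..n} - ?A) = {1..n} - ?A"
    using A permutes_image[OF p] image_set_diff[OF permutes_inj[OF p]] by metis
  then have "conj_into n p (set_stab n (card ({1..n} - ?A)))"
    by (intro conj_into_set_stab[OF p]) auto
  also have "card ({1..n} - ?A) = n - card ?A"
    using sub finite_subset[OF sub] by (simp add: card_Diff_subset)
  finally show "conj_into n p (set_stab n (n - card ?A))" .
qed

section \<open>Conjugation into block stabilizers\<close>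

text \<open>The cyclic shift of \<open>{1..n}\<close> advances residues by one, even where
  \<open>n\<close> wraps to 1, because \<open>m\<close> divides \<open>n\<close>.\<close>

lemma card_residue_class:
  fixes m n i :: nat
  assumes "m dvd n" "i < m"
  shows "card {y \<in> {1..n}. y mod m = i} = n div m"
proof -
  have "bij_betw (\<lambda>y. if y = n then 1 else Suc y) {1..n} {1..n}"
    by (rule bij_betw_byWitness[where f' = "\<lambda>y. if y = 1 then n else y - 1"]) auto
  then have "card {y \<in> {1..n}. y mod m = i} = card {1..n} div m"
  proof (rule card_fibres_cyclic_colouring[rotated])
    fix y assume "y \<in> {1..n}"
    show "(if y = n then 1 else Suc y) mod m = Suc (y mod m) mod m"
      using assms(1) mod_Suc_eq[of n m] mod_Suc_eq[of y m] by simp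
  qed (use assms in auto)
  then show ?thesis by simp
qed

text \<open>The cyclic colouring has the same class sizes as the residues modulo \<open>m\<close>,
  and a permutation matching the two is the conjugator. Proper divisors \<open>m\<close> will give
  block systems, and \<open>m = n\<close> a translation.\<close>

lemma obtain_conj_to_succ_mod:
  fixes m n :: nat
  assumes p: "p permutes {1..n}" and m: "m dvd n" "m > 0"
    and orb: "\<And>x. x \<in> {1..n} \<Longrightarrow> m dvd card (orbit p x)"
  obtains t where "t permutes {1..n}"
    "\<And>x. x \<in> {1..n} \<Longrightarrow> t (p x) mod m = Suc (t x) mod m"
proof -
  have "permutation p" using p by (auto simp: permutation_permutes)
  from obtain_cyclic_colouring[OF this m(2)] obtain f where f: "\<And>x. f x < m"
    and fp: "\<And>x. m dvd card (orbit p x) \<Longrightarrow> f (p x) = Suc (f x) mod m"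
    by blast
  have card: "card {x \<in> {1..n}. f x = i} = card {x \<in> {1..n}. x mod m = i}" for i
  proof (cases "i < m")
    case True
    have "card {x \<in> {1..n}. f x = i} = card {1..n} div m"
      by (rule card_fibres_cyclic_colouring[OF _ permutes_imp_bij[OF p]])
        (use f fp orb True in auto)
    then show ?thesis using card_residue_class[OF m(1) True] by simp
  next
    case False
    then have "{x \<in> {1..n}. f x = i} = {}" "{x \<in> {1..n}. x mod m = i} = {}"
      using f mod_less_divisor[OF m(2)] by (metis (mono_tags, lifting) Collect_empty_eq)+
    then show ?thesis by (simp only:)
  qed
  obtain t where t: "t permutes {1..n}" "\<And>x. x \<in> {1..n} \<Longrightarrow> t x mod m = f x"
    using obtain_permutes_matching_colours[OF _ card] by blast
  show ?thesis
  proof (rule that[OF t(1)])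
    fix x assume x: "x \<in> {1..n}"
    then have "p x \<in> {1..n}" using permutes_in_image[OF p] by blast
    then have "t (p x) mod m = Suc (t x mod m) mod m" using t(2) x fp[OF orb[OF x]] by simp
    then show "t (p x) mod m = Suc (t x) mod m" by (simp add: mod_Suc_eq)
  qed
qed

text \<open>The conjugate moves each block to the next one, cyclically.\<close>

lemma conj_into_mod_stab:
  assumes p: "p permutes {1..n}" and m: "m dvd n" "m > 0"
    and orb: "\<And>x. x \<in> {1..n} \<Longrightarrow> m dvd card (orbit p x)"
  shows "conj_into n p (mod_stab n m)"
proof -
  obtain t where t: "t permutes {1..n}"
    "\<And>x. x \<in> {1..n} \<Longrightarrow> t (p x) mod m = Suc (t x) mod m"
    using obtain_conj_to_succ_mod[OF assms] by blast
  show ?thesis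
  proof (rule conj_intoI[OF t(1) p])
    fix q assume q: "q permutes {1..n}" "\<And>x. x \<in> {1..n} \<Longrightarrow> q (t x) = t (p x)"
    have "q y mod m = Suc (y mod m) mod m" if "y \<in> {1..n}" for y
    proof -
      obtain x where "x \<in> {1..n}" "y = t x" using permutes_image[OF t(1)] \<open>y \<in> {1..n}\<close> by blast
      then show ?thesis using q(2) t(2) by (simp add: mod_Suc_eq)
    qed
    then show "q \<in> mod_stab n m" using q(1) by (simp add: mod_stab_def)
  qed
qed

text \<open>An orbit of size \<open>n / 2\<close> may have odd size, out of reach of cyclic
  colouring. Here the blocks are the orbit and its complement, each mapped to itself.\<close>

lemma conj_into_mod_stab_2:
  assumes p: "p permutes {1..n}" and x: "x \<in> {1..n}" and half: "2 * card (orbit p x) = n"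
  shows "conj_into n p (mod_stab n 2)"
proof -
  let ?A = "orbit p x"
  have sub: "?A \<subseteq> {1..n}" using permutes_orbit_subset[OF p x] .
  have perm: "permutation p" using p by (auto simp: permutation_permutes)
  have pA: "p y \<in> ?A \<longleftrightarrow> y \<in> ?A" for y
    using cyclic_on_f_in[OF p cyclic_on_orbit'[OF perm]] orbit.step[of y p x] by blast
  let ?f = "\<lambda>y. if y \<in> ?A then 1 else 0 :: nat"
  have card: "card {y \<in> {1..n}. ?f y = i} = card {y \<in> {1..n}. y mod 2 = i}" for i
  proof (cases "i < 2")
    case True
    have "{y \<in> {1..n}. ?f y = 1} = ?A" "{y \<in> {1..n}. ?f y = 0} = {1..n} - ?A" using sub by auto
    then have "card {y \<in> {1..n}. ?f y = 1} = n div 2" "card {y \<in> {1..n}. ?f y = 0} = n div 2"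
      using half finite_subset[OF sub] sub by (simp_all add: card_Diff_subset)
    moreover have "i = 0 \<or> i = 1" using True by auto
    ultimately have "card {y \<in> {1..n}. ?f y = i} = n div 2" by blast
    moreover have "2 dvd n" using half by auto
    ultimately show ?thesis using card_residue_class[OF _ True] by simp
  next
    case False
    then have "{y \<in> {1..n}. ?f y = i} = {}" "{y \<in> {1..n}. y mod 2 = i} = {}" by auto
    then show ?thesis by (simp only:)
  qed
  obtain t where t: "t permutes {1..n}" "\<And>y. y \<in> {1..n} \<Longrightarrow> t y mod 2 = ?f y"
    using obtain_permutes_matching_colours[OF _ card] by blast
  show ?thesis
  proof (rule conj_intoI[OF t(1) p])
    fix q assume q: "q permutes {1..n}" "\<And>x. x \<in> {1..n} \<Longrightarrow> q (t x) = t (p x)"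
    have "q y mod 2 = y mod 2" if "y \<in> {1..n}" for y
    proof -
      obtain z where z: "z \<in> {1..n}" "y = t z" using permutes_image[OF t(1)] \<open>y \<in> {1..n}\<close> by blast
      then have "p z \<in> {1..n}" using permutes_in_image[OF p] by blast
      then show ?thesis using z q(2) t(2) pA by simp
    qed
    then show "q \<in> mod_stab n 2" using q(1) by (simp add: mod_stab_def)
  qed
qed

section \<open>Affine permutations\<close>

text \<open>With modulus \<open>n\<close> itself, the conjugate is the translation by 1.\<close>

lemma conj_into_affine_perms_n_cycle:
  assumes p: "p permutes {1..n}" and n: "n > 0"
    and orb: "\<And>x. x \<in> {1..n} \<Longrightarrow> card (orbit p x) = n"
  shows "conj_into n p (affine_perms n)"
proof -
  obtain t where t: "t permutes {1..n}"
    "\<And>x. x \<in> {1..n} \<Longrightarrow> t (p x) mod n = Suc (t x) mod n"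
    using obtain_conj_to_succ_mod[OF p dvd_refl n] orb by auto
  show ?thesis
  proof (rule conj_intoI[OF t(1) p])
    fix q assume q: "q permutes {1..n}" "\<And>x. x \<in> {1..n} \<Longrightarrow> q (t x) = t (p x)"
    have "q y mod n = (1 * y + 1) mod n" if "y \<in> {1..n}" for y
    proof -
      obtain x where "x \<in> {1..n}" "y = t x" using permutes_image[OF t(1)] \<open>y \<in> {1..n}\<close> by blast
      then show ?thesis using q(2) t(2) by simp
    qed
    then show "q \<in> affine_perms n" using q(1) unfolding affine_perms_def by blast
  qed
qed

text \<open>The permutation is conjugated to multiplication by a primitive root, with \<open>n\<close> in the role of 0.\<close>

lemma conj_into_affine_perms_fixed_point:
  assumes p: "p permutes {1..n}" and n: "prime n"
    and z: "z \<in> {1..n}" "card (orbit p z) = n - 1"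
  shows "conj_into n p (affine_perms n)"
proof -
  let ?O = "orbit p z"
  have n2: "n \<ge> 2" using n by (rule prime_ge_2_nat)
  have perm: "permutation p" using p by (auto simp: permutation_permutes)
  have sub: "?O \<subseteq> {1..n}" using permutes_orbit_subset[OF p z(1)] .
  have finO: "finite ?O" using sub finite_subset by blast
  have cyc: "cyclic_on p ?O" using cyclic_on_orbit'[OF perm] .
  have pO: "p y \<in> ?O \<longleftrightarrow> y \<in> ?O" for y
    using cyclic_on_f_in[OF p cyc] orbit.step[of y p z] by blast
  \<comment> \<open>Exactly one point \<open>w\<close> lies outside the orbit, so it is
    fixed.\<close>
  have "card ({1..n} - ?O) = 1" using sub finO z n2 by (simp add: card_Diff_subset)
  then obtain w where w: "{1..n} - ?O = {w}" using card_1_singletonE by blast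
  then have wO: "w \<in> {1..n}" "w \<notin> ?O" and un: "{1..n} = insert w ?O" using sub by auto
  have "p w \<in> {1..n}" "p w \<notin> ?O" using permutes_in_image[OF p] wO pO by blast+
  then have pw: "p w = w" using w by blast
  have "n - 1 > 0" using n2 by simp
  from obtain_cyclic_colouring[OF perm this] obtain f where f: "\<And>x. f x < n - 1"
    and "\<And>x. n - 1 dvd card (orbit p x) \<Longrightarrow> f (p x) = Suc (f x) mod (n - 1)"
    by blast
  then have fp: "f (p x) = Suc (f x) mod (n - 1)" if "x \<in> ?O" for x
    using that z(2) orbit_cyclic_eq3[OF cyc that] by simp
  have bijp: "bij_betw p ?O ?O"
    unfolding bij_betw_def
  proof
    show inj: "inj_on p ?O" using permutes_inj[OF p] inj_on_subset by blast
    show "p ` ?O = ?O" using pO by (intro endo_inj_surj finO inj) blast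
  qed
  \<comment> \<open>The orbit has as many points as there are colours, so a colour identifies its
    point and can serve as an exponent.\<close>
  have fib: "card {x \<in> ?O. f x = i} = 1" if "i < n - 1" for i
    using card_fibres_cyclic_colouring[OF finO bijp, of f "n - 1" i] f fp that z(2) n2 by simp
  have "inj_on f ?O"
  proof (rule inj_onI)
    fix x y assume xy: "x \<in> ?O" "y \<in> ?O" "f x = f y"
    obtain u where u: "{v \<in> ?O. f v = f x} = {u}"
      using fib[OF f] card_1_singletonE by blast
    have "x \<in> {u}" "y \<in> {u}" unfolding u[symmetric] using xy by simp_all
    then show "x = y" by simp
  qed
  moreover have "f ` ?O = {..<n - 1}"
  proof (rule card_subset_eq)
    show "f ` ?O \<subseteq> {..<n - 1}" using f by auto
    show "card (f ` ?O) = card {..<n - 1}" using card_image[OF \<open>inj_on f ?O\<close>] z(2) by simp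
  qed simp
  ultimately have bijf: "bij_betw f ?O {..<n - 1}" by (simp add: bij_betw_def)
  have "n \<in> cyclic_moduli"
  proof (cases "n = 2")
    case False
    then have "odd n" using n prime_odd_nat n2 by auto
    then have "n = n ^ 1 \<and> prime n \<and> odd n \<and> (0::nat) < 1" using n by simp
    then show ?thesis unfolding cyclic_moduli_def by blast
  qed (simp add: cyclic_moduli_def)
  then obtain g where g: "residue_primroot n g" using residue_primroot_iff_in_cyclic_moduli by blast
  have "totatives n = {1..<n}" "totient n = n - 1"
    using n totatives_prime totient_prime by auto
  then have bijg: "bij_betw (\<lambda>i. g ^ i mod n) {..<n - 1} {1..<n}" and euler: "g ^ (n - 1) mod n = 1"
    using residue_primroot_is_generator[OF _ g] n2 g euler_theorem[of g n]
    by (auto simp: residue_primroot_def coprime_commute cong_def)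
  \<comment> \<open>The colour acts as a discrete logarithm: raising it by one multiplies the label
    by \<open>g\<close>.\<close>
  define h where "h x = (if x = w then n else g ^ f x mod n)" for x
  have hO: "h x = g ^ f x mod n" if "x \<in> ?O" for x using that wO by (auto simp: h_def)
  have "bij_betw h ?O {1..<n}"
    using bij_betw_trans[OF bijf bijg] hO bij_betw_cong[of ?O h] by (simp add: o_def)
  moreover have "bij_betw h {w} {n}" by (simp add: h_def bij_betw_def)
  ultimately have "bij_betw h ({w} \<union> ?O) ({n} \<union> {1..<n})"
    by (intro bij_betw_combine) auto
  moreover have "{n} \<union> {1..<n} = {1..n}" using n2 by auto
  ultimately have "bij_betw h {1..n} {1..n}" using un by simp
  then have t: "restrict_id h {1..n} permutes {1..n}" by (rule permutes_restrict_id)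
  show ?thesis
  proof (rule conj_intoI[OF t p])
    fix q assume q: "q permutes {1..n}"
      "\<And>x. x \<in> {1..n} \<Longrightarrow> q (restrict_id h {1..n} x) = restrict_id h {1..n} (p x)"
    have qh: "q (h x) = h (p x)" if "x \<in> {1..n}" for x
      using q(2)[OF that] that permutes_in_image[OF p, of x] by simp
    have "q y mod n = (g * y + 0) mod n" if "y \<in> {1..n}" for y
    proof -
      obtain x where x: "x \<in> {1..n}" "y = h x"
        using \<open>bij_betw h {1..n} {1..n}\<close> \<open>y \<in> {1..n}\<close> unfolding bij_betw_def by blast
      show ?thesis
      proof (cases "x = w")
        case True
        then have "y = n" "q y = n" using x qh[OF x(1)] pw by (simp_all add: h_def)
        then show ?thesis by simp
      next
        case False
        then have xO: "x \<in> ?O" using un x(1) by blast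
        have "q y = g ^ (Suc (f x) mod (n - 1)) mod n"
          using qh[OF x(1)] x(2) hO[of "p x"] pO xO fp by simp
        \<comment> \<open>Where the colour wraps to 0, Euler's theorem equates the powers with
          exponents 0 and \<open>n - 1\<close>.\<close>
        also have "\<dots> = g ^ Suc (f x) mod n"
        proof (cases "Suc (f x) = n - 1")
          case True
          then show ?thesis using euler n2 by simp
        next
          case False
          then show ?thesis using f[of x] by simp
        qed
        finally show ?thesis using x(2) hO[OF xO] by (simp add: mod_mult_right_eq)
      qed
    qed
    then show "q \<in> affine_perms n" using q(1) unfolding affine_perms_def by blast
  qed
qed

text \<open>An \<open>(n - 1)\<close>-cycle has even length, hence is odd, and it is conjugate to an
  affine map. The three-cycle on 1, 2, 3 is even and fixes 4 and 5, but an affine map modulo a prime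
  with two fixed points is the identity.\<close>

lemma admissible_affine_perms:
  assumes n: "prime n" "n \<ge> 5"
  shows "admissible n (affine_perms n)"
  unfolding admissible_def
proof (intro conjI)
  show "subgroup (affine_perms n) (sym_group n)"
  proof (rule subgroup_sym_groupI)
    have "\<forall>x\<in>{1..n}. id x mod n = (1 * x + 0) mod n" by simp
    then show "id \<in> affine_perms n" using permutes_id unfolding affine_perms_def by blast
  next
    fix p q assume pq: "p \<in> affine_perms n" "q \<in> affine_perms n"
    then have perm: "p permutes {1..n}" "q permutes {1..n}" by (simp_all add: affine_perms_def)
    obtain a b c d where ab: "\<And>x. x \<in> {1..n} \<Longrightarrow> p x mod n = (a * x + b) mod n"
      and cd: "\<And>x. x \<in> {1..n} \<Longrightarrow> q x mod n = (c * x + d) mod n"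
      using pq unfolding affine_perms_def by blast
    have "(p \<circ> q) x mod n = ((a * c) * x + (a * d + b)) mod n" if "x \<in> {1..n}" for x
    proof -
      have "q x \<in> {1..n}" using that permutes_in_image[OF perm(2)] by blast
      then have "(p \<circ> q) x mod n = (a * q x + b) mod n" using ab by simp
      also have "\<dots> = (a * (q x mod n) + b) mod n"
        by (metis mod_add_left_eq mod_mult_right_eq)
      also have "\<dots> = (a * ((c * x + d) mod n) + b) mod n" using cd[OF that] by simp
      also have "\<dots> = (a * (c * x + d) + b) mod n"
        by (metis mod_add_left_eq mod_mult_right_eq)
      finally show ?thesis by (simp add: algebra_simps)
    qed
    then show "p \<circ> q \<in> affine_perms n"
      using permutes_compose[OF perm(2,1)] unfolding affine_perms_def by blast
  qed (simp add: affine_perms_def)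
  \<comment> \<open>This cycle fixes \<open>n\<close> and has the other \<open>n - 1\<close> points
    as one orbit.\<close>
  let ?c = "cycle_of_list [1..<n]"
  have "{1..<n} \<subseteq> {1..n}" by auto
  then have c: "?c permutes {1..n}" using cycle_permutes[of "[1..<n]"] permutes_subset by fastforce
  have "orbit ?c 1 = {1..<n}" using orbit_cycle_of_list[of "[1..<n]" 1] n(2) by simp
  then have "conj_into n ?c (affine_perms n)"
    using n by (intro conj_into_affine_perms_fixed_point[OF c n(1), of 1]) auto
  then obtain t where t: "t permutes {1..n}" "t \<circ> ?c \<circ> inv' t \<in> affine_perms n"
    unfolding conj_into_def by blast
  have "odd n" using n prime_odd_nat by auto
  then have "odd (n - 2)" using n(2) by simp
  then have "sign ?c = -1" using sign_cycle_of_list[of "[1..<n]"] by (simp add: numeral_2_eq_2)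
  moreover have "permutation t" "permutation ?c" "permutation (inv' t)" "permutation (t \<circ> ?c)"
    using t(1) c permutes_inv[OF t(1)] permutes_compose[OF c t(1)]
    by (blast intro: permutes_imp_permutation[of "{1..n}"])+
  ultimately have "sign (t \<circ> ?c \<circ> inv' t) = -1"
    by (simp add: sign_compose sign_inverse)
  then show "\<exists>p\<in>affine_perms n. \<not> evenperm p"
    using t(2) by (intro bexI[OF _ t(2)]) (auto simp: sign_def split: if_splits)
  have "1 \<in> {1..n}" "2 \<in> {1..n}" "3 \<in> {1..n}" "distinct [1, 2, 3 :: nat]"
    using n(2) by simp_all
  from obtain_three_cycle[OF this] obtain p where p: "p permutes {1..n}" "evenperm p" "p 1 = 2"
    "p 2 = 3" "p 3 = 1" and fixed: "\<forall>x. x \<notin> {1, 2, 3} \<longrightarrow> p x = x" .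
  have p45: "p 4 = 4" "p 5 = 5" using fixed by simp_all
  have "p \<notin> affine_perms n"
  proof
    assume "p \<in> affine_perms n"
    then obtain a b where "\<And>x. x \<in> {1..n} \<Longrightarrow> [p x = a * x + b] (mod n)"
      unfolding affine_perms_def cong_def by blast
    from this[of 1] this[of 4] this[of 5]
    have "[2 = a + b] (mod n)" "[4 = a * 4 + b] (mod n)" "[5 = a * 5 + b] (mod n)"
      using n(2) p p45 by simp_all
    then have "[int 2 = int (a + b)] (mod int n)"
      "[int 4 = int (a * 4 + b)] (mod int n)" "[int 5 = int (a * 5 + b)] (mod int n)"
      by (simp_all only: cong_int_iff)
    \<comment> \<open>The value at 1 is a combination of the values at 4 and 5, which forces it to be 1.\<close>
    then have "[2 - (4 * 4 - 3 * 5) = (int a + int b) - (4 * (int a * 4 + int b) - 3 * (int a * 5 + int b))] (mod int n)"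
      by (intro cong_diff cong_mult cong_refl) simp_all
    then have "int n dvd 1" by (simp add: cong_0_iff algebra_simps)
    then show False using n(2) by simp
  qed
  then show "\<exists>p. p permutes {1..n} \<and> evenperm p \<and> p \<notin> affine_perms n" using p by blast
qed

lemma card_orbit_bounds:
  assumes p: "p permutes {1..n}" and x: "x \<in> {1..n}"
  shows "1 \<le> card (orbit p x)" "card (orbit p x) \<le> n"
proof -
  have sub: "orbit p x \<subseteq> {1..n}" using permutes_orbit_subset[OF p x] .
  then show "card (orbit p x) \<le> n" using card_mono[OF _ sub] by simp
  show "1 \<le> card (orbit p x)"
    using finite_subset[OF sub] orbit_nonempty[of p x] by (simp add: Suc_le_eq card_gt_0_iff)
qed

lemma conj_into_set_stab_min:
  assumes "p permutes {1..n}" "x \<in> {1..n}"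
  shows "conj_into n p (set_stab n (min (card (orbit p x)) (n - card (orbit p x))))"
  using conj_into_set_stab_orbit[OF assms] by (simp add: min_def)

lemma card_orbit_eq_degree:
  assumes p: "p permutes {1..n}" and x: "x \<in> {1..n}" "card (orbit p x) = n" and y: "y \<in> {1..n}"
  shows "card (orbit p y) = n"
proof -
  have "permutation p" using p by (auto simp: permutation_permutes)
  moreover have "orbit p x = {1..n}"
    using card_subset_eq[OF _ permutes_orbit_subset[OF p x(1)]] x(2) by simp
  ultimately have "orbit p y = orbit p x"
    using orbit_cyclic_eq3[OF cyclic_on_orbit'] y by metis
  then show ?thesis using x(2) by simp
qed

subsection \<open>Coverings of symmetric and alternating groups\<close>

text \<open>There are \<open>n div 4\<close> odd numbers below \<open>n / 2\<close>; each
  contributes a set stabilizer, and the block stabilizer adds one.\<close>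

lemma gamma_le_even:
  assumes n: "n \<ge> 4" "even n"
  shows "gamma (sym_group n) \<le> (n + 4) div 4" "gamma (alt_group n) \<le> (n + 4) div 4"
proof -
  let ?H = "insert (mod_stab n 2) ((\<lambda>j. set_stab n (2 * j + 1)) ` {..<n div 4})"
  have fin: "finite ?H" by simp
  have adm: "admissible n H" if "H \<in> ?H" for H
    using that n admissible_mod_stab[of 2 n] admissible_set_stab[of _ n] by auto
  have cover: "\<exists>H\<in>?H. conj_into n p H" if p: "p permutes {1..n}" for p
  proof (cases "\<forall>x\<in>{1..n}. even (card (orbit p x))")
    case True
    then have "conj_into n p (mod_stab n 2)" using n by (intro conj_into_mod_stab[OF p]) auto
    then show ?thesis by blast
  next
    case False
    then obtain x where x: "x \<in> {1..n}" "odd (card (orbit p x))" by blast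
    let ?k = "min (card (orbit p x)) (n - card (orbit p x))"
    \<comment> \<open>As \<open>n\<close> is even, the complement of an orbit of odd size has odd
      size too.\<close>
    have "odd ?k" using x card_orbit_bounds[OF p x(1)] n by (simp add: min_def)
    then obtain j where j: "?k = 2 * j + 1" by (rule oddE)
    show ?thesis
    proof (cases "2 * card (orbit p x) = n")
      case True
      then have "conj_into n p (mod_stab n 2)" by (rule conj_into_mod_stab_2[OF p x(1)])
      then show ?thesis by blast
    next
      case False
      then have "2 * ?k < n" using card_orbit_bounds[OF p x(1)] by linarith
      then have "j < n div 4" using j n by (auto elim!: evenE)
      moreover have "conj_into n p (set_stab n (2 * j + 1))"
        using conj_into_set_stab_min[OF p x(1)] unfolding j .
      ultimately show ?thesis by blast
    qed
  qed
  have "card ?H \<le> Suc (card ((\<lambda>j. set_stab n (2 * j + 1)) ` {..<n div 4}))"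
    by (rule card_insert_le_m1) simp_all
  also have "\<dots> \<le> Suc (n div 4)" using card_image_le[of "{..<n div 4}"] by simp
  also have "\<dots> = (n + 4) div 4" by simp
  finally have card: "card ?H \<le> (n + 4) div 4" .
  show "gamma (sym_group n) \<le> (n + 4) div 4"
    using gamma_sym_group_le[OF fin adm cover] card by (rule order_trans)
  show "gamma (alt_group n) \<le> (n + 4) div 4"
    using gamma_alt_group_le[OF fin adm cover] card by (rule order_trans)
qed

text \<open>The transitive subgroup \<open>M\<close> takes the place of the set stabilizer for
  \<open>m\<close>, so the family has at most \<open>(n - 1) div 2\<close> members.\<close>

lemma gamma_sym_group_le_odd:
  assumes n: "n \<ge> 5" "odd n"
  shows "gamma (sym_group n) \<le> (n - 1) div 2"
proof -
  have "\<exists>M m. admissible n M \<and> m \<in> {1..(n - 1) div 2} \<and>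
    (\<forall>p. p permutes {1..n} \<longrightarrow> (\<forall>x\<in>{1..n}. card (orbit p x) \<in> {m, n - m, n}) \<longrightarrow> conj_into n p M)"
  proof (cases "prime n")
    case True
    have "conj_into n p (affine_perms n)"
      if p: "p permutes {1..n}" and o: "\<forall>x\<in>{1..n}. card (orbit p x) \<in> {1, n - 1, n}" for p
    \<comment> \<open>If all orbits are single points, \<open>p\<close> is the identity and lies in
      every subgroup; otherwise one long orbit decides which affine map is the model.\<close>
    proof (cases "\<forall>x\<in>{1..n}. card (orbit p x) = 1")
      case True
      have "p x = x" for x
      proof (cases "x \<in> {1..n}")
        case True
        then have "card (orbit p x) = 1" using \<open>\<forall>x\<in>{1..n}. card (orbit p x) = 1\<close> by blast
        then obtain u where u: "orbit p x = {u}" by (rule card_1_singletonE)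
        have "permutation p" using p by (auto simp: permutation_permutes)
        then have "x \<in> orbit p x" by (rule permutation_self_in_orbit)
        then show ?thesis using u orbit_eq_singleton_iff[of p x] by simp
      qed (rule permutes_not_in[OF p])
      then have "p = id" by auto
      moreover have "id \<in> affine_perms n"
        using admissible_affine_perms[OF \<open>prime n\<close> n(1)] subgroup.one_closed sym_group_one
        unfolding admissible_def by metis
      ultimately show ?thesis unfolding conj_into_def
        by (intro exI[of _ id]) (simp add: permutes_id del: id_def)
    next
      case False
      then obtain x where x: "x \<in> {1..n}" "card (orbit p x) \<in> {n - 1, n}" using o by blast
      then consider "card (orbit p x) = n - 1" | "card (orbit p x) = n" by blast
      then show ?thesis
      proof cases
        case 1
        then show ?thesis using conj_into_affine_perms_fixed_point[OF p \<open>prime n\<close> x(1)] by blast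
      next
        case 2
        then show ?thesis
          using card_orbit_eq_degree[OF p x(1)] n(1)
          by (intro conj_into_affine_perms_n_cycle[OF p]) auto
      qed
    qed
    then show ?thesis
      using admissible_affine_perms[OF True n(1)] n
      by (intro exI[of _ "affine_perms n"] exI[of _ 1]) auto
  next
    case False
    then obtain m where m: "m dvd n" "m \<noteq> 1" "m \<noteq> n"
      using n(1) by (auto simp: prime_nat_iff)
    have "m > 0" using m n by (intro Nat.gr0I) auto
    then have m1: "1 < m" "m < n" using m n dvd_imp_le[of m n] by auto
    obtain k where k: "n = m * k" using m(1) by (rule dvdE)
    then have "k \<noteq> 0" "k \<noteq> 1" using m1 by auto
    then have "k \<ge> 2" by simp
    then have "m * 2 \<le> n" unfolding k by (rule mult_le_mono2)
    then have "m \<in> {1..(n - 1) div 2}" using m1 n by (auto elim!: oddE)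
    moreover have "conj_into n p (mod_stab n m)"
      if p: "p permutes {1..n}" and o: "\<forall>x\<in>{1..n}. card (orbit p x) \<in> {m, n - m, n}" for p
    proof (rule conj_into_mod_stab[OF p m(1) \<open>m > 0\<close>])
      fix x assume "x \<in> {1..n}"
      then have "card (orbit p x) \<in> {m, n - m, n}" using o by blast
      then show "m dvd card (orbit p x)" using m(1) by auto
    qed
    ultimately show ?thesis
      using admissible_mod_stab[OF m1] by blast
  qed
  then obtain M m where M: "admissible n M" and m: "m \<in> {1..(n - 1) div 2}"
    and cM: "\<And>p. p permutes {1..n} \<Longrightarrow> (\<And>x. x \<in> {1..n} \<Longrightarrow> card (orbit p x) \<in> {m, n - m, n})
      \<Longrightarrow> conj_into n p M" by metis
  let ?K = "{1..(n - 1) div 2} - {m}"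
  have "gamma (sym_group n) \<le> card (insert M (set_stab n ` ?K))"
  proof (rule gamma_sym_group_le)
    fix H assume "H \<in> insert M (set_stab n ` ?K)"
    then show "admissible n H" using M admissible_set_stab[of _ n] n by auto
  next
    fix p assume p: "p permutes {1..n}"
    show "\<exists>H\<in>insert M (set_stab n ` ?K). conj_into n p H"
    proof (cases "\<forall>x\<in>{1..n}. card (orbit p x) \<in> {m, n - m, n}")
      case True
      then show ?thesis using cM[OF p] by blast
    next
      case False
      then obtain x where x: "x \<in> {1..n}" "card (orbit p x) \<notin> {m, n - m, n}" by blast
      define c where "c = card (orbit p x)"
      \<comment> \<open>Avoiding \<open>m\<close> and \<open>n - m\<close> keeps this minimum
        different from \<open>m\<close>, and avoiding \<open>n\<close> keeps it positive.\<close>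
      let ?k = "min c (n - c)"
      obtain l where l: "n = 2 * l + 1" using n(2) by (rule oddE)
      have c: "1 \<le> c" "c < n" "c \<noteq> m" "c \<noteq> n - m"
        using x(2) card_orbit_bounds[OF p x(1)] unfolding c_def by auto
      then have "n - c \<noteq> m" by arith
      then have "?k \<ge> 1" "?k \<noteq> m" using c by (simp_all add: min_def Suc_le_eq)
      moreover have "?k \<le> l" using l by linarith
      ultimately have "?k \<in> ?K" using l by simp
      moreover have "conj_into n p (set_stab n ?k)"
        unfolding c_def by (rule conj_into_set_stab_min[OF p x(1)])
      ultimately show ?thesis by blast
    qed
  qed simp
  also have "\<dots> \<le> Suc (card (set_stab n ` ?K))" by (rule card_insert_le_m1) simp_all
  also have "\<dots> \<le> Suc (card ?K)" using card_image_le[of ?K "set_stab n"] by simp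
  also have "\<dots> = (n - 1) div 2" using m by (simp add: card_Suc_Diff1)
  finally show ?thesis .
qed

text \<open>By the sign formula, the parity of the number of orbits is that of the degree.\<close>

lemma odd_card_orbits:
  fixes n :: nat
  assumes p: "p permutes {1..n}" "evenperm p" and n: "odd n"
  shows "odd (card (orbit p ` {1..n}))"
proof -
  have "(-1 :: int) ^ card (orbit p ` {1..n}) = -1"
    using sign_eq_card_orbits[OF p(1)] p(2) n by (simp add: sign_def)
  then show ?thesis by (metis neg_one_even_power one_neq_neg_one)
qed

text \<open>The number of orbits is odd, so it is 1 or at least 3; in the latter case the smallest
  orbit has at most a third of the points.\<close>

lemma evenperm_obtain_orbit:
  fixes n :: nat
  assumes p: "p permutes {1..n}" "evenperm p" and n: "odd n"
  obtains x where "x \<in> {1..n}" "card (orbit p x) = n \<or> card (orbit p x) \<le> n div 3"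
proof (cases "card (orbit p ` {1..n}) = 1")
  case True
  then obtain A where A: "orbit p ` {1..n} = {A}" by (rule card_1_singletonE)
  have perm: "permutation p" using p by (auto simp: permutation_permutes)
  have "n \<ge> 1" using n by (cases n) auto
  then have 1: "orbit p 1 = A" "1 \<in> {1..n}" using A by auto
  have "{1..n} \<subseteq> A" using A permutation_self_in_orbit[OF perm] by blast
  moreover have "A \<subseteq> {1..n}" using permutes_orbit_subset[OF p(1)] 1 by blast
  ultimately have "A = {1..n}" by blast
  then show ?thesis using that[of 1] 1 by simp
next
  case False
  note witness = that
  let ?C = "orbit p ` {1..n}"
  have perm: "permutation p" using p by (auto simp: permutation_permutes)
  have "card ?C \<noteq> 0" "card ?C \<noteq> 2" using odd_card_orbits[OF p n] by (metis even_zero, metis dvd_refl)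
  then have C: "card ?C \<ge> 3" using False by linarith
  show ?thesis
  proof (rule ccontr)
    \<comment> \<open>If every orbit had more than \<open>n div 3\<close> points, three disjoint
      ones would already have more than \<open>n\<close>.\<close>
    assume "\<not> thesis"
    then have big: "n div 3 + 1 \<le> card A" if A: "A \<in> ?C" for A
    proof -
      obtain x where "x \<in> {1..n}" "A = orbit p x" using A by blast
      then show ?thesis using witness[of x] \<open>\<not> thesis\<close> by fastforce
    qed
    have "\<Union>?C = {1..n}"
      using permutes_orbit_subset[OF p(1)] permutation_self_in_orbit[OF perm] by blast
    moreover have "card (\<Union>?C) = (\<Sum>A\<in>?C. card A)"
    proof (rule card_Union_disjoint)
      show "pairwise disjnt ?C"
      proof (intro pairwiseI)
        fix A B assume AB: "A \<in> ?C" "B \<in> ?C" "A \<noteq> B"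
        have cyc: "cyclic_on p A" "cyclic_on p B" using AB cyclic_on_orbit'[OF perm] by blast+
        show "disjnt A B"
          unfolding disjnt_iff using orbit_cyclic_eq3[OF cyc(1)] orbit_cyclic_eq3[OF cyc(2)] AB(3) by metis
      qed
      show "finite A" if "A \<in> ?C" for A
        using that permutes_orbit_subset[OF p(1)] finite_subset by blast
    qed
    moreover have "(\<Sum>A\<in>?C. card A) \<ge> card ?C * (n div 3 + 1)"
      using sum_bounded_below[of ?C "n div 3 + 1" card] big by simp
    ultimately have "n \<ge> card ?C * (n div 3 + 1)" by simp
    moreover have "card ?C * (n div 3 + 1) \<ge> 3 * (n div 3 + 1)" using C by (rule mult_le_mono1)
    ultimately have "3 * (n div 3 + 1) \<le> n" by (rule order_trans[rotated])
    then show False by presburger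
  qed
qed

text \<open>Among even permutations only \<open>n\<close>-cycles can escape the set stabilizers with
  \<open>k\<close> up to \<open>n div 3\<close>, so one further subgroup \<open>M\<close> is
  enough.\<close>

lemma gamma_alt_group_le_odd:
  assumes n: "n \<ge> 5" "odd n"
  shows "gamma (alt_group n) \<le> (n + 3) div 3"
proof -
  \<comment> \<open>For prime \<open>n\<close> an \<open>n\<close>-cycle is conjugate to a
    translation; for composite \<open>n\<close> it is conjugate to a map that permutes the residue
    classes of a proper divisor cyclically.\<close>
  have "\<exists>M. admissible n M \<and>
    (\<forall>p. p permutes {1..n} \<longrightarrow> (\<forall>x\<in>{1..n}. card (orbit p x) = n) \<longrightarrow> conj_into n p M)"
  proof (cases "prime n")
    case True
    then show ?thesis
      using admissible_affine_perms[OF True n(1)] conj_into_affine_perms_n_cycle n(1)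
      by (intro exI[of _ "affine_perms n"]) auto
  next
    case False
    then obtain m where m: "m dvd n" "m \<noteq> 1" "m \<noteq> n"
      using n(1) by (auto simp: prime_nat_iff)
    have "m > 0" using m n by (intro Nat.gr0I) auto
    then have "1 < m" "m < n" using m n dvd_imp_le[of m n] by auto
    then show ?thesis
      using admissible_mod_stab[of m n] conj_into_mod_stab[of _ n m] m(1)
      by (intro exI[of _ "mod_stab n m"]) auto
  qed
  then obtain M where M: "admissible n M" and cM: "\<And>p. p permutes {1..n} \<Longrightarrow>
    (\<And>x. x \<in> {1..n} \<Longrightarrow> card (orbit p x) = n) \<Longrightarrow> conj_into n p M" by metis
  let ?K = "{1..n div 3}"
  have "gamma (alt_group n) \<le> card (insert M (set_stab n ` ?K))"
  proof (rule gamma_alt_group_le)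
    fix H assume "H \<in> insert M (set_stab n ` ?K)"
    then show "admissible n H" using M admissible_set_stab[of _ n] n by auto
  next
    fix p assume p: "p permutes {1..n}" "evenperm p"
    obtain x where x: "x \<in> {1..n}" "card (orbit p x) = n \<or> card (orbit p x) \<le> n div 3"
      using evenperm_obtain_orbit[OF p n(2)] .
    from x(2) show "\<exists>H\<in>insert M (set_stab n ` ?K). conj_into n p H"
    proof
      assume "card (orbit p x) = n"
      then show ?thesis using cM[OF p(1)] card_orbit_eq_degree[OF p(1) x(1)] by blast
    next
      assume "card (orbit p x) \<le> n div 3"
      then have "card (orbit p x) \<in> ?K" using card_orbit_bounds[OF p(1) x(1)] by simp
      then show ?thesis using conj_into_set_stab_orbit(1)[OF p(1) x(1)] by blast
    qed
  qed simp
  also have "\<dots> \<le> Suc (card (set_stab n ` ?K))" by (rule card_insert_le_m1) simp_all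
  also have "\<dots> \<le> Suc (card ?K)" using card_image_le[of ?K "set_stab n"] by simp
  also have "\<dots> = (n + 3) div 3" by simp
  finally show ?thesis .
qed

theorem theoremA:
  fixes n :: nat and G :: "(nat \<Rightarrow> nat) monoid"
  assumes "n \<ge> 4"
    and "G = sym_group n \<or> G = alt_group n"
  shows "(even n \<longrightarrow> gamma G \<le> (n + 4) div 4) \<and>
         (odd n \<and> G = sym_group n \<longrightarrow> gamma G \<le> (n - 1) div 2) \<and>
         (odd n \<and> G = alt_group n \<longrightarrow> gamma G \<le> (n + 3) div 3)"
proof (cases "even n")
  case True
  then show ?thesis using gamma_le_even[OF assms(1)] assms(2) by auto
next
  case False
  then have "n \<noteq> 4" by auto
  then have "n \<ge> 5" using assms(1) by simp
  then show ?thesis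
    using False gamma_sym_group_le_odd gamma_alt_group_le_odd by simp
qed

end
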